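(* Let $\beta>0$ and $p>0$, and let $\mathcal{G}_{\beta,p}$ be the set of all probability distributions $G$ on $(0,\infty)$ with $G((\beta,1])\ge p$. Then the equation $$1-e^{-\lambda}=(\lambda p)^{1/\beta}\,e^{1-\lambda p}$$ has a unique solution $\lambda=\lambda_0=\lambda_0(p,\beta)$ in the interval $\left(\frac{1}{p\beta},\infty\right)$, and for every $G\in\mathcal{G}_{\beta,p}$ and every $\lambda>0$ the convergence rate $\rho(G,\lambda)$ of the Model 1 workload process with arrival rate $\lambda$ and service distribution $G$ satisfies $$\rho(G,\lambda)\le 1-e^{-\lambda_0}<1.$$
   Context: Model 1 (M/G/1 workload with truncated service at capacity 1). Let $T_0=0$ and let the inter-arrival times $T_i-T_{i-1}$, $i\ge1$, be i.i.d. exponential with mean $1/\lambda$; let $(S_n)_{n\ge1}$ be i.i.d. with distribution $G$ on $(0,\infty)$, independent of $(T_n)$. For $x\in[0,1]$ define $V^{1,x}_0=x$, $$V^{1,x}_t=\max[V^{1,x}_{T_{n-1}}-(t-T_{n-1}),0]\quad (T_{n-1}\le t<T_n,\ n\ge1),\qquad V^{1,x}_{T_n}=\min[S_n+V^{1,x}_{T_n-},\,1]\quad(n\ge1),$$ where $V^{1,x}_{T_n-}$ is the left limit at $T_n$. This is a Markov process on $[0,1]$ with a unique invariant probability distribution $\pi$. Convergence rate: with $\|\mu-\nu\|_{TV}=\sup_{A\text{ Borel}}|\mu(A)-\nu(A)|$, put $d(t)=\sup_{x\in[0,1]}\|\mathbb{P}(V_t^{1,x}\in\cdot)-\pi\|_{TV}$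 and $\rho(G,\lambda)=\limsup_{t\to\infty}d(t)^{1/t}$. (The quantity $1-\rho(G,\lambda)$ is called the spectral gap.) *)

theory Defs
  imports "HOL-Probability.Probability"
begin

text \<open>
  Arrivals and services are indexed from 0: \<open>X i\<close> is the gap between arrival epochs \<open>i\<close> and \<open>i + 1\<close>
  (epoch 0 being time 0, with no arrival), and \<open>S i\<close> is the service brought by arrival \<open>i + 1\<close>.
\<close>

definition epoch :: "(nat \<Rightarrow> real) \<Rightarrow> nat \<Rightarrow> real" where
  "epoch X n = (\<Sum>i<n. X i)"

text \<open>
  Workload at the arrival epochs, just after the (truncated) service has been added. The inner
  maximum is the left limit of the workload at epoch \<open>n + 1\<close>.
\<close>

primrec workload_at_epoch :: "(nat \<Rightarrow> real) \<Rightarrow> (nat \<Rightarrow> real) \<Rightarrow> real \<Rightarrow> nat \<Rightarrow> real" where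
  "workload_at_epoch X S x 0 = x"
| "workload_at_epoch X S x (Suc n) = min (S n + max (workload_at_epoch X S x n - X n) 0) 1"

text \<open>
  For positive gaps with divergent sum there is exactly one index \<open>n\<close> as below. On the exceptional
  null set, \<open>LEAST\<close> (rather than \<open>THE\<close>) keeps the workload a measurable function of the gaps
  and services.
\<close>

definition workload :: "(nat \<Rightarrow> real) \<Rightarrow> (nat \<Rightarrow> real) \<Rightarrow> real \<Rightarrow> real \<Rightarrow> real" where
  "workload X S x t =
    (let n = (LEAST n. epoch X n \<le> t \<and> t < epoch X (Suc n))
     in max (workload_at_epoch X S x n - (t - epoch X n)) 0)"

definition positive_distribution :: "real measure \<Rightarrow> bool" where
  "positive_distribution G \<longleftrightarrow> prob_space G \<and> sets G = sets borel \<and> measure G {0<..} = 1"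

definition service_class :: "real \<Rightarrow> real \<Rightarrow> real measure set" where
  "service_class \<beta> p = {G. positive_distribution G \<and> measure G {\<beta><..1} \<ge> p}"

text \<open>
  Independence of the family indexed by the disjoint sum says that all gaps and all services
  are jointly independent: each sequence is independent, and the two sequences are independent of
  each other.
\<close>

locale truncated_workload_model = prob_space M
  for M :: "'a measure" +
  fixes X S :: "nat \<Rightarrow> 'a \<Rightarrow> real" and rate :: real and G :: "real measure"
  assumes rate_pos: "rate > 0"
    and service_distribution: "positive_distribution G"
    and gap_distributed: "\<And>i. distributed M lborel (X i) (exponential_density rate)"
    and service_distributed: "\<And>i. distr M borel (S i) = G"
    and independent: "indep_vars (\<lambda>_. borel) (case_sum X S) (UNIV :: (nat + nat) set)"

definition workload_law ::
  "'a measure \<Rightarrow> (nat \<Rightarrow> 'a \<Rightarrow> real) \<Rightarrow> (nat \<Rightarrow> 'a \<Rightarrow> real) \<Rightarrow> real \<Rightarrow> real \<Rightarrow> real measure" where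
  "workload_law M X S t x = distr M borel (\<lambda>\<omega>. workload (\<lambda>i. X i \<omega>) (\<lambda>i. S i \<omega>) x t)"

definition invariant_distribution ::
  "'a measure \<Rightarrow> (nat \<Rightarrow> 'a \<Rightarrow> real) \<Rightarrow> (nat \<Rightarrow> 'a \<Rightarrow> real) \<Rightarrow> real measure \<Rightarrow> bool" where
  "invariant_distribution M X S \<pi> \<longleftrightarrow>
    prob_space \<pi> \<and> sets \<pi> = sets borel \<and> measure \<pi> {0..1} = 1 \<and>
    (\<forall>t\<ge>0. \<forall>B\<in>sets borel. emeasure \<pi> B = (\<integral>\<^sup>+x. emeasure (workload_law M X S t x) B \<partial>\<pi>))"

definition tv_dist :: "real measure \<Rightarrow> real measure \<Rightarrow> real" where
  "tv_dist \<mu> \<nu> = (SUP B\<in>sets borel. \<bar>measure \<mu> B - measure \<nu> B\<bar>)"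

definition max_tv_dist ::
  "'a measure \<Rightarrow> (nat \<Rightarrow> 'a \<Rightarrow> real) \<Rightarrow> (nat \<Rightarrow> 'a \<Rightarrow> real) \<Rightarrow> real measure \<Rightarrow> real \<Rightarrow> real" where
  "max_tv_dist M X S \<pi> t = (SUP x\<in>{0..1}. tv_dist (workload_law M X S t x) \<pi>)"

definition convergence_rate ::
  "'a measure \<Rightarrow> (nat \<Rightarrow> 'a \<Rightarrow> real) \<Rightarrow> (nat \<Rightarrow> 'a \<Rightarrow> real) \<Rightarrow> real measure \<Rightarrow> ereal" where
  "convergence_rate M X S \<pi> = Limsup at_top (\<lambda>t. ereal (max_tv_dist M X S \<pi> t powr (1 / t)))"

definition critical_equation :: "real \<Rightarrow> real \<Rightarrow> real \<Rightarrow> bool" where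
  "critical_equation p \<beta> l \<longleftrightarrow> 1 - exp (- l) = (l * p) powr (1 / \<beta>) * exp (1 - l * p)"

definition critical_rate :: "real \<Rightarrow> real \<Rightarrow> real" where
  "critical_rate p \<beta> = (THE l. l \<in> {1 / (p * \<beta>)<..} \<and> critical_equation p \<beta> l)"

end

theory Submission
  imports Defs "HOL-Real_Asymp.Real_Asymp"
begin

text \<open>
  Trajectories driven by the same arrivals and services merge as soon as either a gap of length at
  least 1 empties all of them, or the lowest one, started at 0, reaches the capacity 1. The total
  variation distance at time \<open>t\<close> is at most the probability that no merging has occurred by then. A
  Chernoff bound for the gaps gives the rate \<open>1 - exp (- \<lambda>)\<close>, which increases with \<open>\<lambda>\<close>; a Chernoff
  bound for the accumulated service gives a rate of at most
  \<open>(\<lambda> p) powr (1 / \<beta>) * exp (1 - \<lambda> p)\<close>, which decreases for \<open>\<lambda> > 1 / (p \<beta>)\<close>. The critical rate is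
  where the two bounds cross, so the first one is used below it and the second one above it.
\<close>

section \<open>The critical equation\<close>

text \<open>The logarithm \<open>f\<close> of the expression has derivative
  \<open>1 / (l * \<beta>) - p\<close>, which is negative for
  \<open>l > 1 / (p * \<beta>)\<close>.\<close>

lemma critical_rhs_strict_antimono:
  fixes \<beta> p a b :: real
  assumes "\<beta> > 0" "p > 0" "1 / (p * \<beta>) \<le> a" "a < b"
  shows "(b * p) powr (1 / \<beta>) * exp (1 - b * p) < (a * p) powr (1 / \<beta>) * exp (1 - a * p)"
proof -
  have "0 < 1 / (p * \<beta>)" using assms by simp
  then have a: "a > 0" using assms by linarith
  define f where "f = (\<lambda>l. ln (l * p) / \<beta> + 1 - l * p)"
  have "f b < f a"
  \<comment> \<open>The derivative vanishes at the permitted left endpoint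
    \<open>1 / (p * \<beta>)\<close>, so its sign is required on the open interval only.\<close>
  proof (rule DERIV_neg_imp_decreasing_open[OF \<open>a < b\<close>])
    fix x assume x: "a < x" "x < b"
    have "(f has_real_derivative 1 / (x * \<beta>) - p) (at x)"
      unfolding f_def using x a assms by (auto intro!: derivative_eq_intros simp: field_simps)
    moreover have "1 / (x * \<beta>) < p"
    proof -
      have "1 / (p * \<beta>) < x" using x assms by linarith
      then show ?thesis using assms x a by (simp add: field_simps)
    qed
    ultimately show "\<exists>y. (f has_real_derivative y) (at x) \<and> y < 0" by fastforce
  next
    show "continuous_on {a..b} f" unfolding f_def using a assms
      by (auto intro!: continuous_intros)
  qed
  moreover have "(l * p) powr (1 / \<beta>) * exp (1 - l * p) = exp (f l)" if "l > 0" for l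
    using that assms by (simp add: f_def powr_def exp_add[symmetric] algebra_simps)
  ultimately show ?thesis using a assms by simp
qed

text \<open>The logarithm of this value is \<open>(\<beta> - 1 - ln \<beta>) / \<beta>\<close>, so
  the bound is \<open>ln \<beta> \<le> \<beta> - 1\<close> in disguise.\<close>

lemma critical_rhs_left_endpoint:
  fixes \<beta> p :: real
  assumes "\<beta> > 0" "p > 0"
  shows "1 \<le> (1 / (p * \<beta>) * p) powr (1 / \<beta>) * exp (1 - 1 / (p * \<beta>) * p)"
proof -
  have "ln \<beta> \<le> \<beta> - 1" using assms by (simp add: ln_le_minus_one)
  then have "0 \<le> (\<beta> - 1 - ln \<beta>) / \<beta>" using assms by simp
  also have "\<dots> = 1 / \<beta> * ln (1 / \<beta>) + 1 - 1 / \<beta>"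
    using assms by (simp add: ln_div field_simps)
  finally have "1 \<le> exp (1 / \<beta> * ln (1 / \<beta>) + (1 - 1 / \<beta>))" by simp
  also have "\<dots> = (1 / \<beta>) powr (1 / \<beta>) * exp (1 - 1 / \<beta>)"
    using assms by (simp add: powr_def exp_add)
  finally show ?thesis using assms by simp
qed

text \<open>The difference \<open>f\<close> of the two sides is strictly decreasing from the left
  endpoint on, positive there, and tends to -1 at infinity.\<close>

lemma ex1_critical_rate:
  fixes \<beta> p :: real
  assumes "\<beta> > 0" "p > 0"
  shows "\<exists>!l. l \<in> {1 / (p * \<beta>)<..} \<and> critical_equation p \<beta> l"
proof -
  define R where "R = (\<lambda>l. (l * p) powr (1 / \<beta>) * exp (1 - l * p))"
  define f where "f = (\<lambda>l. R l - (1 - exp (- l)))"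
  let ?a = "1 / (p * \<beta>)"
  have a: "?a > 0" using assms by simp
  have dec: "f y < f x" if "?a \<le> x" "x < y" for x y
    using critical_rhs_strict_antimono[OF assms that] that by (simp add: f_def R_def add_strict_mono)
  have eq: "critical_equation p \<beta> l \<longleftrightarrow> f l = 0" for l
    by (auto simp: critical_equation_def f_def R_def)
  have "1 \<le> R ?a" using critical_rhs_left_endpoint[OF assms] by (simp only: R_def)
  moreover have "0 < exp (- ?a)" by simp
  ultimately have fa: "f ?a > 0" unfolding f_def by linarith
  have "(f \<longlongrightarrow> -1) at_top" unfolding f_def R_def using assms by real_asymp
  then have "eventually (\<lambda>l. f l < 0) at_top" by (rule order_tendstoD) simp
  then obtain b where b: "b > ?a" "f b < 0"
    using eventually_happens[OF eventually_conj[OF _ eventually_gt_at_top[of ?a]]]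
    by (metis (mono_tags, lifting) trivial_limit_at_top_linorder)
  have "l * p \<noteq> 0" if "l \<in> {?a..b}" for l using that a assms(2) by (smt (verit) atLeastAtMost_iff mult_pos_pos)
  then have "continuous_on {?a..b} f" unfolding f_def R_def
    by (intro continuous_intros) auto
  then obtain l where l: "?a \<le> l" "l \<le> b" "f l = 0"
    using IVT2'[of f b 0 ?a] b fa by auto
  with fa have "?a < l" by (cases "?a = l") auto
  with l have "l \<in> {?a<..} \<and> critical_equation p \<beta> l" by (simp add: eq)
  moreover have "l' = l" if "l' \<in> {?a<..} \<and> critical_equation p \<beta> l'" for l'
    using that dec[of l l'] dec[of l' l] l \<open>?a < l\<close> by (cases l l' rule: linorder_cases) (auto simp: eq)
  ultimately show ?thesis by blast
qed

section \<open>Pathwise coupling of trajectories\<close>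

lemma epoch_0 [simp]: "epoch X 0 = 0"
  and epoch_Suc [simp]: "epoch X (Suc n) = epoch X n + X n"
  by (simp_all add: epoch_def)

lemma workload_at_epoch_le_1: "x \<le> 1 \<Longrightarrow> workload_at_epoch X S x n \<le> 1"
  by (cases n) auto

lemma workload_at_epoch_mono: "x \<le> y \<Longrightarrow> workload_at_epoch X S x n \<le> workload_at_epoch X S y n"
  by (induction n) (auto simp: min_def max_def)

lemma workload_at_epoch_coupled:
  assumes "m \<le> n" "workload_at_epoch X S x m = workload_at_epoch X S y m"
  shows "workload_at_epoch X S x n = workload_at_epoch X S y n"
  using assms by (induction rule: dec_induct) auto

text \<open>The long gap drains every workload before the next arrival, after which it equals
  \<open>min (S i) 1\<close> whatever the start.\<close>

lemma coupled_after_long_gap: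
  assumes "i < n" "X i \<ge> 1" "x \<le> 1" "y \<le> 1"
  shows "workload_at_epoch X S x n = workload_at_epoch X S y n"
proof (rule workload_at_epoch_coupled[of "Suc i"])
  show "workload_at_epoch X S x (Suc i) = workload_at_epoch X S y (Suc i)"
    using workload_at_epoch_le_1[of x X S i] workload_at_epoch_le_1[of y X S i] assms by simp
qed (use assms in simp)

text \<open>Below capacity the truncation is inactive, so each step adds \<open>S n\<close> in full
  and removes at most \<open>X n\<close>.\<close>

lemma services_le_of_unsaturated:
  assumes "\<And>k. k \<le> n \<Longrightarrow> workload_at_epoch X S 0 k < 1"
  shows "(\<Sum>i<n. S i) - epoch X n \<le> workload_at_epoch X S 0 n"
  using assms
proof (induction n)
  case (Suc n)
  have "workload_at_epoch X S 0 (Suc n) = S n + max (workload_at_epoch X S 0 n - X n) 0"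
    using Suc.prems[of "Suc n"] by (auto simp: min_def split: if_splits)
  with Suc show ?case by fastforce
qed simp

text \<open>If the trajectory from 0 never reached capacity, the preceding bound would put it at 1
  or more at epoch \<open>n\<close>. So it reaches 1 at some \<open>k \<le> n\<close>, and
  monotonicity together with the cap squeezes all other trajectories to 1 there.\<close>

lemma coupled_of_many_services:
  assumes "(\<Sum>i<n. S i) \<ge> 1 + epoch X n" "x \<in> {0..1}" "y \<in> {0..1}"
  shows "workload_at_epoch X S x n = workload_at_epoch X S y n"
proof -
  have "\<not> (\<forall>k\<le>n. workload_at_epoch X S 0 k < 1)"
    using services_le_of_unsaturated[of n X S] assms(1) by fastforce
  then obtain k where k: "k \<le> n" "workload_at_epoch X S 0 k \<ge> 1" by force
  have "workload_at_epoch X S z k = 1" if "z \<in> {0..1}" for z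
    using that k(2) workload_at_epoch_le_1[of z X S k] workload_at_epoch_mono[of 0 z X S k] by auto
  then show ?thesis using assms k(1) workload_at_epoch_coupled[of k n] by simp
qed

lemma ex_current_index:
  assumes "0 \<le> t" "t < epoch X m"
  shows "\<exists>n. epoch X n \<le> t \<and> t < epoch X (Suc n)"
proof (rule ccontr)
  assume "\<not> ?thesis"
  then have "epoch X n \<le> t" for n using assms(1) by (induction n) (auto simp: not_less)
  with assms(2) show False by (meson not_less)
qed

section \<open>Two analytic estimates\<close>

text \<open>A constant prefactor is invisible to the rate because \<open>C powr (1 / t)\<close>
  tends to 1.\<close>

lemma limsup_powr_inverse_le:
  fixes d :: "real \<Rightarrow> real"
  assumes "C > 0" "\<And>t. t > 0 \<Longrightarrow> 0 \<le> d t" "\<And>t. t > 0 \<Longrightarrow> d t \<le> C * exp (k * t)"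
  shows "Limsup at_top (\<lambda>t. ereal (d t powr (1 / t))) \<le> ereal (exp k)"
proof -
  have "Limsup at_top (\<lambda>t. ereal (d t powr (1 / t))) \<le> Limsup at_top (\<lambda>t. ereal (C powr (1 / t) * exp k))"
  proof (rule Limsup_mono, rule eventually_mono[OF eventually_gt_at_top[of 0]])
    fix t :: real assume t: "0 < t"
    have "d t powr (1 / t) \<le> (C * exp (k * t)) powr (1 / t)"
      using assms t by (intro powr_mono2) auto
    also have "\<dots> = C powr (1 / t) * exp k"
      using assms t by (simp add: powr_mult exp_powr_real)
    finally show "ereal (d t powr (1 / t)) \<le> ereal (C powr (1 / t) * exp k)" by simp
  qed
  also have "\<dots> = ereal (exp k)"
  proof (rule lim_imp_Limsup)
    have "((\<lambda>t. C powr (1 / t) * exp k) \<longlongrightarrow> exp k) at_top" using assms(1) by real_asymp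
    then show "((\<lambda>t. ereal (C powr (1 / t) * exp k)) \<longlongrightarrow> ereal (exp k)) at_top" by simp
  qed simp
  finally show ?thesis .
qed

text \<open>The exponent satisfies \<open>exp s * (1 - exp (- l)) = 1\<close>. On
  \<open>x < 1\<close> the factor \<open>exp (s * x)\<close> stays below \<open>exp s\<close>, so
  the truncated moment is strictly below \<open>exp s\<close> times the probability of a gap shorter
  than 1, which is 1.\<close>

lemma truncated_exponential_moment_less_1:
  fixes l :: real
  assumes "l > 0"
  defines "s \<equiv> - ln (1 - exp (- l))"
  shows "\<exists>c. 0 \<le> c \<and> c < 1 \<and>
    (\<integral>\<^sup>+x. ennreal (exponential_density l x) * ennreal (exp (s * x) * indicator {..<1} x) \<partial>lborel) = ennreal c"
proof -
  have q: "0 < 1 - exp (- l)" using assms by simp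
  have s: "s > 0" using q by (simp add: s_def ln_less_zero)
  have exp_s: "exp s = inverse (1 - exp (- l))" using q by (simp add: s_def exp_minus)
  define u where "u = l - s"
  \<comment> \<open>An antiderivative of \<open>exp (u * y)\<close>. The case \<open>u = 0\<close>
    does occur, namely when \<open>exp (- l) = 1 / 2\<close>.\<close>
  define K where "K = (\<lambda>y. if u = 0 then y else (exp (u * y) - 1) / u)"
  have K: "(K has_real_derivative exp (u * y)) (at y)" for y
    by (cases "u = 0") (auto simp: K_def[abs_def] intro!: derivative_eq_intros)
  define F where "F = (\<lambda>x. - l * exp (- u) * K (1 - x))"
  have F: "(F has_real_derivative l * exp (- u * x)) (at x)" for x
    unfolding F_def
    by (rule derivative_eq_intros DERIV_chain'[OF _ K] refl)+
      (simp add: exp_add[symmetric] exp_minus[symmetric] algebra_simps flip: exp_add)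
  define c where "c = F 1 - F 0"
  have "(\<integral>\<^sup>+x. ennreal (exponential_density l x) * ennreal (exp (s * x) * indicator {..<1} x) \<partial>lborel)
    = (\<integral>\<^sup>+x. ennreal (l * exp (- u * x)) * indicator {0..1} x \<partial>lborel)"
  proof (rule nn_integral_cong_AE, rule AE_mp[OF AE_lborel_singleton[of 1]], rule AE_I2, rule impI)
    fix x :: real assume "x \<noteq> 1"
    then show "ennreal (exponential_density l x) * ennreal (exp (s * x) * indicator {..<1} x)
        = ennreal (l * exp (- u * x)) * indicator {0..1} x"
      using assms
      by (auto simp: exponential_density_def u_def ennreal_mult[symmetric] exp_add[symmetric]
          algebra_simps split: split_indicator)
  qed
  also have "\<dots> = ennreal c"
    unfolding c_def
    by (rule nn_integral_FTC_Icc) (use assms F in \<open>auto intro: has_field_derivative_at_within\<close>)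
  finally have int: "(\<integral>\<^sup>+x. ennreal (exponential_density l x) *
      ennreal (exp (s * x) * indicator {..<1} x) \<partial>lborel) = ennreal c" .
  have "c \<ge> 0"
    unfolding c_def using DERIV_nonneg_imp_nondecreasing[of 0 1 F] F assms by fastforce
  \<comment> \<open>This integrates \<open>exp (u * y) < exp (l * y)\<close> over the unit interval;
    under \<open>y = 1 - x\<close> it is the comparison of \<open>exp (s * x)\<close> with
    \<open>exp s\<close>.\<close>
  have "exp l / l - K 1 > exp 0 / l - K 0"
  proof -
    define H where "H = (\<lambda>y. exp (l * y) / l - K y)"
    have H: "(H has_real_derivative exp (l * y) - exp (u * y)) (at y)" for y
      unfolding H_def using assms by (auto intro!: derivative_eq_intros K)
    have "H 0 < H 1"
    proof (rule DERIV_pos_imp_increasing_open[of 0 1 H])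
      fix y :: real assume "0 < y" "y < 1"
      then have "0 < exp (l * y) - exp (u * y)" using s by (simp add: u_def)
      with H show "\<exists>d. (H has_real_derivative d) (at y) \<and> 0 < d" by blast
    next
      show "continuous_on {0..1} H" by (rule DERIV_continuous_on[OF has_field_derivative_at_within[OF H]])
    qed simp
    then show ?thesis by (simp add: H_def)
  qed
  then have "K 1 - K 0 < (exp l - 1) / l" by (simp add: diff_divide_distrib)
  then have "l * exp (- u) * (K 1 - K 0) < l * exp (- u) * ((exp l - 1) / l)"
    using assms by (intro mult_strict_left_mono) auto
  also have "\<dots> = exp s * (1 - exp (- l))"
    using assms by (simp add: u_def exp_diff exp_minus field_simps)
  also have "\<dots> = 1" using q by (simp add: exp_s)
  finally have "c < 1" by (simp add: c_def F_def algebra_simps)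
  with \<open>0 \<le> c\<close> int show ?thesis by blast
qed

section \<open>Measurability, independence and Poisson arrivals\<close>

text \<open>Serves to extract the gaps and the services from the joint family. Injectivity makes the
  singleton blocks \<open>{f j}\<close> disjoint, and evaluation at \<open>f j\<close> recovers the
  variable.\<close>

lemma (in prob_space) indep_vars_reindex:
  assumes "indep_vars M' X I" "inj_on f J" "f ` J \<subseteq> I"
  shows "indep_vars (\<lambda>j. M' (f j)) (\<lambda>j. X (f j)) J"
proof -
  have "indep_vars (\<lambda>j. PiM {f j} M') (\<lambda>j \<omega>. restrict (\<lambda>i. X i \<omega>) {f j}) J"
    using assms by (intro indep_vars_restrict) (auto simp: disjoint_family_on_def inj_on_def)
  from indep_vars_compose2[OF this, of "\<lambda>j g. g (f j)" "\<lambda>j. M' (f j)"] show ?thesis by simp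
qed

context truncated_workload_model
begin

abbreviation arrival_time :: "nat \<Rightarrow> 'a \<Rightarrow> real" where
  "arrival_time n \<omega> \<equiv> epoch (\<lambda>i. X i \<omega>) n"

abbreviation workload_process :: "real \<Rightarrow> real \<Rightarrow> 'a \<Rightarrow> real" where
  "workload_process x t \<omega> \<equiv> workload (\<lambda>i. X i \<omega>) (\<lambda>i. S i \<omega>) x t"

lemma measurable_gap [measurable]: "X i \<in> borel_measurable M"
  using distributed_measurable[OF gap_distributed[of i]] by simp

lemma measurable_service [measurable]: "S i \<in> borel_measurable M"
  using independent unfolding indep_vars_def by (metis UNIV_I sum.case(2))

lemma measurable_arrival_time [measurable]: "arrival_time n \<in> borel_measurable M"
  unfolding epoch_def by measurable

lemma measurable_workload [measurable]: "workload_process x t \<in> borel_measurable M"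
proof -
  have [measurable]: "(\<lambda>\<omega>. workload_at_epoch (\<lambda>i. X i \<omega>) (\<lambda>i. S i \<omega>) x n) \<in> borel_measurable M" for n
    by (induction n) (simp_all, measurable)
  show ?thesis
    unfolding workload_def Let_def
    \<comment> \<open>The index selected by \<open>LEAST\<close> is a measurable random natural
      number, so it suffices to treat each fixed index.\<close>
    by (rule measurable_compose_countable[where
          f = "\<lambda>n \<omega>. max (workload_at_epoch (\<lambda>i. X i \<omega>) (\<lambda>i. S i \<omega>) x n - (t - arrival_time n \<omega>)) 0"])
      (simp_all del: epoch_Suc)
qed

lemma indep_gaps: "indep_vars (\<lambda>_. borel) X UNIV"
  using indep_vars_reindex[OF independent inj_Inl subset_UNIV] by simp

lemma indep_services: "indep_vars (\<lambda>_. borel) S UNIV"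
  using indep_vars_reindex[OF independent inj_Inr subset_UNIV] by simp

lemma AE_gap_nonneg: "AE \<omega> in M. \<forall>i. 0 \<le> X i \<omega>"
  unfolding AE_all_countable
proof
  fix i
  have "emeasure M {\<omega> \<in> space M. X i \<omega> \<le> 0} = 0"
    using erlang_distributed_le[OF gap_distributed[of i], of 0] rate_pos
    by (simp add: emeasure_eq_measure erlang_CDF_at0)
  then show "AE \<omega> in M. 0 \<le> X i \<omega>" by (intro AE_I[where N = "{\<omega> \<in> space M. X i \<omega> \<le> 0}"]) auto
qed

lemma AE_service_pos: "AE \<omega> in M. \<forall>i. 0 < S i \<omega>"
  unfolding AE_all_countable
proof
  fix i
  interpret G: prob_space G using service_distribution by (simp add: positive_distribution_def)
  have "AE s in G. s \<in> {0<..}"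
    using service_distribution G.AE_in_set_eq_1[of "{0<..}"] by (simp add: positive_distribution_def)
  then show "AE \<omega> in M. 0 < S i \<omega>"
    unfolding service_distributed[of i, symmetric] by (simp add: AE_distr_iff)
qed

lemma prob_arrival_time_le:
  assumes "0 \<le> t"
  shows "prob {\<omega> \<in> space M. arrival_time n \<omega> \<le> t} =
    1 - (\<Sum>k<n. (rate * t) ^ k * exp (- rate * t) / fact k)"
\<comment> \<open>The Erlang density with index \<open>k\<close> belongs to \<open>k + 1\<close>
  summands, so the empty sum is treated separately.\<close>
proof (cases n)
  case 0
  then show ?thesis using assms by (simp add: prob_space)
next
  case (Suc m)
  have "distributed M lborel (\<lambda>\<omega>. \<Sum>i\<in>{..<n}. X i \<omega>) (erlang_density (card {..<n} - 1) rate)"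
    using rate_pos Suc
    by (intro exponential_distributed_sum gap_distributed indep_vars_subset[OF indep_gaps]) auto
  from erlang_distributed_le[OF this rate_pos assms] show ?thesis
    using Suc assms by (simp add: epoch_def erlang_CDF_def lessThan_Suc_atMost)
qed

text \<open>Nonnegative gaps make the events of arrival by time \<open>t\<close> decrease in
  \<open>n\<close> almost surely; the difference of two consecutive Erlang distribution functions is
  a single Poisson weight.\<close>

lemma prob_current_index:
  assumes "0 \<le> t"
  shows "prob {\<omega> \<in> space M. arrival_time n \<omega> \<le> t \<and> t < arrival_time (Suc n) \<omega>} =
    (rate * t) ^ n * exp (- rate * t) / fact n"
proof -
  let ?E = "\<lambda>n. {\<omega> \<in> space M. arrival_time n \<omega> \<le> t}"
  have "prob {\<omega> \<in> space M. arrival_time n \<omega> \<le> t \<and> t < arrival_time (Suc n) \<omega>} = prob (?E n - ?E (Suc n))"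
    by (rule arg_cong[where f = prob]) auto
  also have "\<dots> = prob (?E n) - prob (?E n \<inter> ?E (Suc n))"
    by (simp add: finite_measure_Diff' del: epoch_Suc)
  also have "prob (?E n \<inter> ?E (Suc n)) = prob (?E (Suc n))"
    by (rule finite_measure_eq_AE, rule AE_mp[OF AE_gap_nonneg]) (auto intro!: AE_I2, smt (verit))
  finally show ?thesis using assms by (simp only: prob_arrival_time_le) simp
qed

text \<open>The Poisson weights sum to 1, so the probability of at least \<open>n\<close> arrivals
  by time \<open>t\<close> vanishes as \<open>n\<close> grows.\<close>

lemma AE_ex_arrival_after:
  assumes "0 \<le> t"
  shows "AE \<omega> in M. \<exists>m. t < arrival_time m \<omega>"
proof -
  let ?N = "{\<omega> \<in> space M. \<forall>m. arrival_time m \<omega> \<le> t}"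
  have "(\<lambda>k. exp (- rate * t) * ((rate * t) ^ k /\<^sub>R fact k)) sums (exp (- rate * t) * exp (rate * t))"
    by (intro sums_mult exp_converges)
  then have "(\<lambda>k. (rate * t) ^ k * exp (- rate * t) / fact k) sums 1"
    by (simp add: exp_add[symmetric] divide_inverse mult_ac)
  then have "(\<lambda>n. 1 - (\<Sum>k<n. (rate * t) ^ k * exp (- rate * t) / fact k)) \<longlonglongrightarrow> 1 - 1"
    unfolding sums_def by (intro tendsto_intros)
  moreover have "prob ?N \<le> 1 - (\<Sum>k<n. (rate * t) ^ k * exp (- rate * t) / fact k)" for n
    unfolding prob_arrival_time_le[OF assms, symmetric]
    by (rule finite_measure_mono) auto
  ultimately have "prob ?N \<le> 0" by (intro LIMSEQ_le_const) auto
  then have "emeasure M ?N = 0" by (simp add: emeasure_eq_measure measure_le_0_iff)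
  then show ?thesis by (intro AE_I[where N = ?N]) (auto simp: not_less)
qed

text \<open>The index depends on the gaps alone, so one \<open>n\<close> serves all initial values
  \<open>x\<close>; this quantifier order is what permits comparing trajectories.\<close>

lemma AE_workload_eq:
  assumes "0 \<le> t"
  shows "AE \<omega> in M. \<exists>n. arrival_time n \<omega> \<le> t \<and> t < arrival_time (Suc n) \<omega> \<and>
    (\<forall>x. workload_process x t \<omega> =
      max (workload_at_epoch (\<lambda>i. X i \<omega>) (\<lambda>i. S i \<omega>) x n - (t - arrival_time n \<omega>)) 0)"
  using AE_ex_arrival_after[OF assms]
proof (rule AE_mp, intro AE_I2 impI)
  fix \<omega> assume "\<exists>m. t < arrival_time m \<omega>"
  then have "\<exists>n. arrival_time n \<omega> \<le> t \<and> t < arrival_time (Suc n) \<omega>"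
    using ex_current_index[OF assms] by blast
  from LeastI_ex[OF this] show "\<exists>n. arrival_time n \<omega> \<le> t \<and> t < arrival_time (Suc n) \<omega> \<and>
    (\<forall>x. workload_process x t \<omega> =
      max (workload_at_epoch (\<lambda>i. X i \<omega>) (\<lambda>i. S i \<omega>) x n - (t - arrival_time n \<omega>)) 0)"
    unfolding workload_def Let_def by blast
qed

section \<open>From coupling to the convergence rate\<close>

text \<open>The coupling inequality: trajectories from all starting points live on the same space
  and can differ only on \<open>D\<close>, up to a null set. The lower bound 0 is recorded because
  the later estimate of \<open>powr\<close> requires it.\<close>

lemma max_tv_dist_coupling:
  assumes D [measurable]: "D \<in> events"
    and coupled: "AE \<omega> in M. \<omega> \<notin> D \<longrightarrow>
      (\<forall>x\<in>{0..1}. \<forall>y\<in>{0..1}. workload_process x t \<omega> = workload_process y t \<omega>)"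
    and \<pi>: "invariant_distribution M X S \<pi>" and t: "0 \<le> t"
  shows "0 \<le> max_tv_dist M X S \<pi> t" "max_tv_dist M X S \<pi> t \<le> prob D"
proof -
  interpret \<pi>: prob_space \<pi> using \<pi> by (simp add: invariant_distribution_def)
  have [simp]: "sets \<pi> = sets borel" and sp: "space \<pi> = UNIV"
    using \<pi> sets_eq_imp_space_eq[of \<pi> borel] by (auto simp: invariant_distribution_def)
  have AE_\<pi>: "AE y in \<pi>. y \<in> {0..1}"
    using \<pi> \<pi>.AE_in_set_eq_1[of "{0..1}"] by (simp add: invariant_distribution_def)
  let ?L = "workload_law M X S t"
  have L: "prob_space (?L x)" "sets (?L x) = sets borel" "space (?L x) = UNIV" for x
    by (auto simp: workload_law_def intro!: prob_space_distr)
  have le: "emeasure (?L y) B \<le> emeasure (?L x) B + emeasure M D"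
    if [measurable]: "B \<in> sets borel" and xy: "x \<in> {0..1}" "y \<in> {0..1}" for x y B
  proof -
    let ?E = "\<lambda>x. workload_process x t -` B \<inter> space M"
    have "emeasure M (?E y) \<le> emeasure M (?E x \<union> D)"
    proof (rule emeasure_mono_AE)
      show "AE \<omega> in M. \<omega> \<in> ?E y \<longrightarrow> \<omega> \<in> ?E x \<union> D"
        using coupled
      proof (rule AE_mp, intro AE_I2 impI)
        fix \<omega> assume "\<omega> \<notin> D \<longrightarrow> (\<forall>x\<in>{0..1}. \<forall>y\<in>{0..1}. workload_process x t \<omega> = workload_process y t \<omega>)"
          and E: "\<omega> \<in> ?E y"
        then have "\<omega> \<in> D \<or> workload_process x t \<omega> = workload_process y t \<omega>" using xy by blast
        then show "\<omega> \<in> ?E x \<union> D" using E by auto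
      qed
    qed measurable
    also have "\<dots> \<le> emeasure M (?E x) + emeasure M D" by (rule emeasure_subadditive) measurable
    finally show ?thesis by (simp add: workload_law_def emeasure_distr)
  qed
  \<comment> \<open>Invariance writes \<open>\<pi>\<close> as a mixture of the laws started from
    \<open>y\<close> in \<open>{0..1}\<close>, to each of which \<open>le\<close> applies.\<close>
  have upper: "measure \<pi> B \<le> measure (?L x) B + prob D"
    if B: "B \<in> sets borel" and x: "x \<in> {0..1}" for x B
  proof -
    interpret L: prob_space "?L x" by (rule L)
    have "emeasure \<pi> B = (\<integral>\<^sup>+y. emeasure (?L y) B \<partial>\<pi>)"
      using \<pi> t B by (auto simp: invariant_distribution_def)
    also have "\<dots> \<le> (\<integral>\<^sup>+y. emeasure (?L x) B + emeasure M D \<partial>\<pi>)"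
      using AE_\<pi> by (intro nn_integral_mono_AE) (rule AE_mp, assumption, intro AE_I2 impI le[OF B x])
    also have "\<dots> = emeasure (?L x) B + emeasure M D" by (simp add: \<pi>.emeasure_space_1)
    finally show ?thesis
      by (simp add: \<pi>.emeasure_eq_measure L.emeasure_eq_measure emeasure_eq_measure flip: ennreal_plus)
  qed
  have tv: "\<bar>measure (?L x) B - measure \<pi> B\<bar> \<le> prob D"
    if B: "B \<in> sets borel" and x: "x \<in> {0..1}" for x B
  proof -
    interpret L: prob_space "?L x" by (rule L)
    \<comment> \<open>Passing to the complement turns the one-sided bound into the reverse
      one.\<close>
    have "- B \<in> sets borel" using B by simp
    from upper[OF this x] have "measure (?L x) B \<le> measure \<pi> B + prob D"
      using B \<pi>.prob_compl[of B] L.prob_compl[of B] by (simp add: L sp Compl_eq_Diff_UNIV)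
    with upper[OF that] show ?thesis by linarith
  qed
  have tv_le: "tv_dist (?L x) \<pi> \<le> prob D" if "x \<in> {0..1}" for x
    unfolding tv_dist_def by (rule cSUP_least) (use tv that sets.empty_sets in auto)
  have tv_ge: "0 \<le> tv_dist (?L x) \<pi>" if "x \<in> {0..1}" for x
    unfolding tv_dist_def
    by (rule cSUP_upper2[of _ _ "{}"]) (use tv[OF _ that] in \<open>auto intro!: bdd_aboveI2\<close>)
  show "max_tv_dist M X S \<pi> t \<le> prob D"
    unfolding max_tv_dist_def by (rule cSUP_least) (use tv_le in auto)
  show "0 \<le> max_tv_dist M X S \<pi> t"
    unfolding max_tv_dist_def
    by (rule cSUP_upper2[of _ _ 0]) (use tv_le tv_ge in \<open>auto intro!: bdd_aboveI2[where M = "prob D"]\<close>)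
qed

text \<open>A union bound in which \<open>n\<close> stands for the number of arrivals by time
  \<open>t\<close>; the prefactor \<open>C\<close> disappears in the limit superior.\<close>

lemma rate_bound_of_uncoupled_events:
  assumes D [measurable]: "\<And>t n. D t n \<in> events"
    and coupled: "\<And>t. 0 \<le> t \<Longrightarrow> AE \<omega> in M. (\<forall>n. \<omega> \<notin> D t n) \<longrightarrow>
      (\<forall>x\<in>{0..1}. \<forall>y\<in>{0..1}. workload_process x t \<omega> = workload_process y t \<omega>)"
    and bound: "\<And>t n. 0 \<le> t \<Longrightarrow> emeasure M (D t n) \<le> ennreal (a t n)"
    and a: "\<And>t n. 0 \<le> t \<Longrightarrow> 0 \<le> a t n"
    and sums: "\<And>t. 0 \<le> t \<Longrightarrow> a t sums (C * exp (k * t))"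
    and C: "C > 0" and \<pi>: "invariant_distribution M X S \<pi>"
  shows "convergence_rate M X S \<pi> \<le> ereal (exp k)"
  unfolding convergence_rate_def
proof (rule limsup_powr_inverse_le[OF C])
  fix t :: real assume "0 < t"
  then have t: "0 \<le> t" by simp
  have AE: "AE \<omega> in M. \<omega> \<notin> (\<Union>n. D t n) \<longrightarrow>
      (\<forall>x\<in>{0..1}. \<forall>y\<in>{0..1}. workload_process x t \<omega> = workload_process y t \<omega>)"
    using coupled[OF t] by simp
  have *: "(\<Union>n. D t n) \<in> events" by measurable
  show "0 \<le> max_tv_dist M X S \<pi> t" by (rule max_tv_dist_coupling(1)[OF * AE \<pi> t])
  have "emeasure M (\<Union>n. D t n) \<le> (\<Sum>n. emeasure M (D t n))"
    by (rule emeasure_subadditive_countably) auto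
  also have "\<dots> \<le> (\<Sum>n. ennreal (a t n))" by (intro suminf_le bound t summableI)
  also have "\<dots> = ennreal (C * exp (k * t))" by (intro suminf_ennreal_eq a sums t)
  finally have "prob (\<Union>n. D t n) \<le> C * exp (k * t)"
    using C by (simp add: emeasure_eq_measure)
  with max_tv_dist_coupling(2)[OF * AE \<pi> t]
  show "max_tv_dist M X S \<pi> t \<le> C * exp (k * t)" by linarith
qed

section \<open>Merging by a long gap\<close>

text \<open>
  With no gap of length at least 1 before time \<open>t\<close>, the sum of the gaps completed by then exceeds
  \<open>t - 1\<close>; the bound is a Chernoff estimate for sums of gaps conditioned to be shorter than 1.
\<close>

lemma convergence_rate_le_idle:
  assumes \<pi>: "invariant_distribution M X S \<pi>"
  shows "convergence_rate M X S \<pi> \<le> ereal (1 - exp (- rate))"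
proof -
  \<comment> \<open>Chosen so that \<open>exp (- s)\<close> is the target rate; the moment
    \<open>c < 1\<close> then makes the union bound over \<open>n\<close> a geometric
    series.\<close>
  define s where "s = - ln (1 - exp (- rate))"
  have q: "0 < 1 - exp (- rate)" using rate_pos by simp
  have "s > 0" using rate_pos q by (simp add: s_def ln_less_zero)
  obtain c where c: "0 \<le> c" "c < 1"
    and c_eq: "(\<integral>\<^sup>+x. ennreal (exponential_density rate x) *
      ennreal (exp (s * x) * indicator {..<1} x) \<partial>lborel) = ennreal c"
    using truncated_exponential_moment_less_1[OF rate_pos] unfolding s_def by blast
  define w where "w = (\<lambda>x::real. ennreal (exp (s * x) * indicator {..<1} x))"
  have [measurable]: "w \<in> borel_measurable borel" unfolding w_def by measurable
  have gap_int: "(\<integral>\<^sup>+\<omega>. w (X i \<omega>) \<partial>M) = ennreal c" for i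
    using distributed_nn_integral[OF gap_distributed[of i], of w] c_eq by (simp add: w_def)
  have prod_int: "(\<integral>\<^sup>+\<omega>. (\<Prod>i<n. w (X i \<omega>)) \<partial>M) = ennreal (c ^ n)" for n
  proof -
    have "(\<integral>\<^sup>+\<omega>. (\<Prod>i<n. w (X i \<omega>)) \<partial>M) = (\<Prod>i<n. \<integral>\<^sup>+\<omega>. w (X i \<omega>) \<partial>M)"
      by (intro indep_vars_nn_integral indep_vars_compose2[OF indep_vars_subset[OF indep_gaps]]) auto
    then show ?thesis using c by (simp add: gap_int ennreal_power)
  qed
  \<comment> \<open>The event involves the first \<open>n\<close> gaps only, so its Chernoff bound
    factorises. The last condition concerns the gap in progress at \<open>t\<close>: once that has
    lasted 1, every trajectory is at 0.\<close>
  define D where "D = (\<lambda>t n. {\<omega> \<in> space M. (\<forall>i<n. X i \<omega> < 1) \<and> t - arrival_time n \<omega> < 1})"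
  have "convergence_rate M X S \<pi> \<le> ereal (exp (- s))"
  proof (rule rate_bound_of_uncoupled_events[where D = D and a = "\<lambda>t n. exp (s * (1 - t)) * c ^ n"
        and C = "exp s / (1 - c)"])
    show "D t n \<in> events" for t n unfolding D_def by measurable
  next
    fix t :: real assume t: "0 \<le> t"
    show "AE \<omega> in M. (\<forall>n. \<omega> \<notin> D t n) \<longrightarrow>
        (\<forall>x\<in>{0..1}. \<forall>y\<in>{0..1}. workload_process x t \<omega> = workload_process y t \<omega>)"
      using AE_workload_eq[OF t] AE_space
    proof eventually_elim
      case (elim \<omega>)
      let ?W = "workload_at_epoch (\<lambda>i. X i \<omega>) (\<lambda>i. S i \<omega>)"
      from elim obtain n where n: "arrival_time n \<omega> \<le> t"
        "\<And>x. workload_process x t \<omega> = max (?W x n - (t - arrival_time n \<omega>)) 0" by blast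
      show ?case
      proof (intro impI ballI)
        fix x y :: real assume "\<forall>n. \<omega> \<notin> D t n" and xy: "x \<in> {0..1}" "y \<in> {0..1}"
        then have "\<omega> \<notin> D t n" by blast
        then consider i where "i < n" "1 \<le> X i \<omega>" | "1 \<le> t - arrival_time n \<omega>"
          using elim unfolding D_def by fastforce
        then show "workload_process x t \<omega> = workload_process y t \<omega>"
        proof cases
          case 1
          then have "?W x n = ?W y n" using coupled_after_long_gap[of i n] xy by simp
          then show ?thesis using n by simp
        next
          case 2
          then show ?thesis
            using n xy workload_at_epoch_le_1[of x _ _ n] workload_at_epoch_le_1[of y _ _ n]
            by (smt (verit) atLeastAtMost_iff)
        qed
      qed
    qed
  next
    fix t :: real and n assume t: "0 \<le> t"
    have "indicator (D t n) \<omega> \<le> ennreal (exp (s * (1 - t))) * (\<Prod>i<n. w (X i \<omega>))" for \<omega>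
    proof (cases "\<omega> \<in> D t n")
      case True
      then have "(\<Prod>i<n. w (X i \<omega>)) = (\<Prod>i<n. ennreal (exp (s * X i \<omega>)))"
        by (intro prod.cong) (auto simp: D_def w_def)
      also have "\<dots> = ennreal (exp (s * arrival_time n \<omega>))"
        by (simp add: prod_ennreal exp_sum[symmetric] epoch_def sum_distrib_left)
      finally have "ennreal (exp (s * (1 - t))) * (\<Prod>i<n. w (X i \<omega>)) =
          ennreal (exp (s * (1 - t + arrival_time n \<omega>)))"
        by (simp add: ennreal_mult[symmetric] exp_add[symmetric] algebra_simps)
      moreover have "1 \<le> exp (s * (1 - t + arrival_time n \<omega>))"
        using True \<open>s > 0\<close> by (simp add: D_def)
      ultimately show ?thesis using True by simp
    qed simp
    then have "(\<integral>\<^sup>+\<omega>. indicator (D t n) \<omega> \<partial>M)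
        \<le> (\<integral>\<^sup>+\<omega>. ennreal (exp (s * (1 - t))) * (\<Prod>i<n. w (X i \<omega>)) \<partial>M)"
      by (intro nn_integral_mono) auto
    also have "\<dots> = ennreal (exp (s * (1 - t)) * c ^ n)"
      using c by (simp add: nn_integral_cmult prod_int ennreal_mult)
    also have "(\<integral>\<^sup>+\<omega>. indicator (D t n) \<omega> \<partial>M) = emeasure M (D t n)"
      by (rule nn_integral_indicator) (simp add: D_def)
    finally show "emeasure M (D t n) \<le> ennreal (exp (s * (1 - t)) * c ^ n)" .
  next
    fix t :: real
    have "(\<lambda>n. exp (s * (1 - t)) * c ^ n) sums (exp (s * (1 - t)) * (1 / (1 - c)))"
      using c by (intro sums_mult geometric_sums) simp
    also have "exp (s * (1 - t)) * (1 / (1 - c)) = exp s / (1 - c) * exp (- s * t)"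
      by (simp add: exp_add[symmetric] algebra_simps)
    finally show "(\<lambda>n. exp (s * (1 - t)) * c ^ n) sums (exp s / (1 - c) * exp (- s * t))" .
  qed (use c \<pi> in auto)
  also have "exp (- s) = 1 - exp (- rate)" using q by (simp add: s_def)
  finally show ?thesis .
qed

section \<open>Merging by saturation\<close>

text \<open>
  While the trajectory started at 0 stays below 1 nothing is truncated, so the services received
  add up to at most \<open>1 + t\<close>. The exponent \<open>\<theta>\<close> is the optimal one in the Chernoff bound for the
  compound Poisson variable that counts \<open>\<beta>\<close> for every service in \<open>{\<beta><..1}\<close>.
\<close>

lemma convergence_rate_le_saturation:
  assumes \<pi>: "invariant_distribution M X S \<pi>" and G: "G \<in> service_class \<beta> p"
    and \<beta>: "\<beta> > 0" and p: "p > 0" and large: "1 / (p * \<beta>) \<le> rate"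
  shows "convergence_rate M X S \<pi> \<le> ereal ((\<beta> * (rate * p)) powr (1 / \<beta>) * exp (1 / \<beta> - rate * p))"
proof -
  interpret G: prob_space G using service_distribution by (simp add: positive_distribution_def)
  have [measurable_cong]: "sets G = sets borel"
    using service_distribution by (simp add: positive_distribution_def)
  have spG: "space G = UNIV" using sets_eq_imp_space_eq[OF \<open>sets G = sets borel\<close>] by simp
  have pG: "p \<le> measure G {\<beta><..1}" using G by (simp add: service_class_def)
  then have p1: "p \<le> 1" using G.prob_le_1 order_trans by blast
  \<comment> \<open>The mean service rate counted by \<open>b\<close> is at least
    \<open>\<beta> * (rate * p)\<close>; its being at least 1 is what makes \<open>\<theta>\<close>
    nonnegative.\<close>
  have load: "1 \<le> \<beta> * (rate * p)" using large \<beta> p by (simp add: field_simps)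
  define \<theta> where "\<theta> = ln (\<beta> * (rate * p)) / \<beta>"
  have \<theta>: "0 \<le> \<theta>" using load \<beta> by (simp add: \<theta>_def)
  have exp_\<theta>: "exp (- (\<theta> * \<beta>)) = 1 / (\<beta> * (rate * p))"
    using load \<beta> by (simp add: \<theta>_def exp_minus inverse_eq_divide)
  \<comment> \<open>The moment of \<open>w\<close> for a service with mass exactly \<open>p\<close>
    on \<open>{\<beta><..1}\<close>; more mass there only lowers the moment.\<close>
  define \<phi> where "\<phi> = 1 - p * (1 - exp (- (\<theta> * \<beta>)))"
  have "0 \<le> 1 - exp (- (\<theta> * \<beta>))" using \<theta> \<beta> by simp
  then have "p * (1 - exp (- (\<theta> * \<beta>))) \<le> 1 * 1" using p p1 by (intro mult_mono) auto
  then have \<phi>: "0 \<le> \<phi>" by (simp add: \<phi>_def)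
  define b where "b = (\<lambda>s. if s \<in> {\<beta><..1} then \<beta> else 0)"
  have [measurable]: "b \<in> borel_measurable borel" unfolding b_def by measurable
  define w where "w = (\<lambda>s. ennreal (exp (- \<theta> * b s)))"
  have [measurable]: "w \<in> borel_measurable borel" unfolding w_def by measurable
  have service_int: "(\<integral>\<^sup>+\<omega>. w (S i \<omega>) \<partial>M) \<le> ennreal \<phi>" for i
  proof -
    have "(\<integral>\<^sup>+\<omega>. w (S i \<omega>) \<partial>M) = (\<integral>\<^sup>+s. w s \<partial>G)"
      unfolding service_distributed[of i, symmetric] by (subst nn_integral_distr) auto
    also have "\<dots> = (\<integral>\<^sup>+s. ennreal (exp (- (\<theta> * \<beta>))) * indicator {\<beta><..1} s + indicator (- {\<beta><..1}) s \<partial>G)"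
      by (intro nn_integral_cong) (auto simp: w_def b_def split: split_indicator)
    also have "\<dots> = ennreal (exp (- (\<theta> * \<beta>))) * emeasure G {\<beta><..1} + emeasure G (- {\<beta><..1})"
      by (subst nn_integral_add) (auto simp: nn_integral_cmult_indicator \<open>sets G = sets borel\<close>)
    also have "\<dots> = ennreal (exp (- (\<theta> * \<beta>)) * measure G {\<beta><..1} + (1 - measure G {\<beta><..1}))"
      using G.prob_compl[of "{\<beta><..1}"]
      by (simp add: G.emeasure_eq_measure ennreal_mult ennreal_plus spG \<open>sets G = sets borel\<close> Compl_eq_Diff_UNIV)
    also have "\<dots> \<le> ennreal \<phi>"
    proof (rule ennreal_leI)
      have "p * (1 - exp (- (\<theta> * \<beta>))) \<le> measure G {\<beta><..1} * (1 - exp (- (\<theta> * \<beta>)))"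
        using pG \<open>0 \<le> 1 - exp (- (\<theta> * \<beta>))\<close> by (rule mult_right_mono)
      then show "exp (- (\<theta> * \<beta>)) * measure G {\<beta><..1} + (1 - measure G {\<beta><..1}) \<le> \<phi>"
        by (simp add: \<phi>_def algebra_simps)
    qed
    finally show ?thesis .
  qed
  \<comment> \<open>\<open>N\<close> fixes the number of arrivals and depends on gaps only,
    \<open>B\<close> depends on services only, so their probabilities multiply.\<close>
  define N where "N = (\<lambda>t n. {\<omega> \<in> space M. arrival_time n \<omega> \<le> t \<and> t < arrival_time (Suc n) \<omega>})"
  define B where "B = (\<lambda>t n. {\<omega> \<in> space M. (\<Sum>i<n. b (S i \<omega>)) \<le> 1 + t})"
  have [measurable]: "N t n \<in> events" "B t n \<in> events" for t n
    unfolding N_def B_def by measurable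
  have B_bound: "prob (B t n) \<le> exp (\<theta> * (1 + t)) * \<phi> ^ n" for t n
  proof -
    have "indicator (B t n) \<omega> \<le> ennreal (exp (\<theta> * (1 + t))) * (\<Prod>i<n. w (S i \<omega>))" for \<omega>
    proof (cases "\<omega> \<in> B t n")
      case True
      have "ennreal (exp (\<theta> * (1 + t))) * (\<Prod>i<n. w (S i \<omega>)) =
          ennreal (exp (\<theta> * (1 + t - (\<Sum>i<n. b (S i \<omega>)))))"
        by (simp add: w_def prod_ennreal exp_sum[symmetric] ennreal_mult[symmetric] exp_add[symmetric]
            sum_negf sum_distrib_left right_diff_distrib)
      moreover have "1 \<le> exp (\<theta> * (1 + t - (\<Sum>i<n. b (S i \<omega>))))"
        using True \<theta> by (simp add: B_def)
      ultimately show ?thesis using True by simp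
    qed simp
    then have "(\<integral>\<^sup>+\<omega>. indicator (B t n) \<omega> \<partial>M)
        \<le> (\<integral>\<^sup>+\<omega>. ennreal (exp (\<theta> * (1 + t))) * (\<Prod>i<n. w (S i \<omega>)) \<partial>M)"
      by (intro nn_integral_mono) auto
    also have "\<dots> = ennreal (exp (\<theta> * (1 + t))) * (\<Prod>i<n. \<integral>\<^sup>+\<omega>. w (S i \<omega>) \<partial>M)"
      by (subst nn_integral_cmult, measurable, rule arg_cong2[where f = "(*)"], simp,
          intro indep_vars_nn_integral indep_vars_compose2[OF indep_vars_subset[OF indep_services]]) auto
    also have "\<dots> \<le> ennreal (exp (\<theta> * (1 + t))) * (\<Prod>i<n. ennreal \<phi>)"
      by (intro mult_left_mono prod_mono_ennreal service_int) simp
    also have "\<dots> = ennreal (exp (\<theta> * (1 + t)) * \<phi> ^ n)"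
      using \<phi> by (simp add: ennreal_power ennreal_mult)
    finally show ?thesis using \<phi> by (simp add: emeasure_eq_measure)
  qed
  have indep: "prob (N t n \<inter> B t n) = prob (N t n) * prob (B t n)" for t n
  proof -
    let ?XS = "case_sum X S"
    let ?I = "Inl ` {..n} :: (nat + nat) set" and ?J = "Inr ` {..<n} :: (nat + nat) set"
    \<comment> \<open>Real-valued codings of the two events through the disjoint blocks of gaps
      \<open>0..n\<close> and services \<open>0..n-1\<close>; the event \<open>N t n\<close> is
      \<open>f = 1\<close>.\<close>
    define f where "f = (\<lambda>g :: nat + nat \<Rightarrow> real.
      indicator {u. u \<le> t} (\<Sum>i<n. g (Inl i)) * indicator {u. t < u} ((\<Sum>i<n. g (Inl i)) + g (Inl n)) :: real)"
    define h where "h = (\<lambda>g :: nat + nat \<Rightarrow> real. \<Sum>i<n. b (g (Inr i)))"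
    have meas: "(\<lambda>g. g (Inl i)) \<in> borel_measurable (PiM ?I (\<lambda>_. borel :: real measure))" if "i \<le> n" for i
      using that by (intro measurable_component_singleton) auto
    have [measurable]: "(\<lambda>g. \<Sum>i<n. g (Inl i)) \<in> borel_measurable (PiM ?I (\<lambda>_. borel :: real measure))"
      by (intro borel_measurable_sum meas) simp
    have [measurable]: "(\<lambda>g. g (Inl n)) \<in> borel_measurable (PiM ?I (\<lambda>_. borel :: real measure))"
      by (rule meas) simp
    have [measurable]: "f \<in> borel_measurable (PiM ?I (\<lambda>_. borel))"
      unfolding f_def by measurable
    have [measurable]: "h \<in> borel_measurable (PiM ?J (\<lambda>_. borel))"
      unfolding h_def
      by (intro borel_measurable_sum measurable_compose[OF measurable_component_singleton]) auto
    have "indep_var borel (f \<circ> (\<lambda>\<omega>. restrict (\<lambda>i. ?XS i \<omega>) ?I))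
        borel (h \<circ> (\<lambda>\<omega>. restrict (\<lambda>i. ?XS i \<omega>) ?J))"
      by (intro indep_var_compose[OF indep_var_restrict[OF independent]]) auto
    also have "f \<circ> (\<lambda>\<omega>. restrict (\<lambda>i. ?XS i \<omega>) ?I) =
        (\<lambda>\<omega>. indicator {u. u \<le> t} (arrival_time n \<omega>) * indicator {u. t < u} (arrival_time (Suc n) \<omega>))"
      by (auto simp: f_def epoch_def fun_eq_iff)
    also have "h \<circ> (\<lambda>\<omega>. restrict (\<lambda>i. ?XS i \<omega>) ?J) = (\<lambda>\<omega>. \<Sum>i<n. b (S i \<omega>))"
      by (auto simp: h_def)
    finally have ind: "indep_var
        borel (\<lambda>\<omega>. indicator {u. u \<le> t} (arrival_time n \<omega>) * indicator {u. t < u} (arrival_time (Suc n) \<omega>))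
        borel (\<lambda>\<omega>. \<Sum>i<n. b (S i \<omega>))"
      (is "indep_var borel ?f borel ?h") .
    have N_eq: "N t n = ?f -` {1} \<inter> space M" and B_eq: "B t n = ?h -` {..1 + t} \<inter> space M"
      by (auto simp: N_def B_def split: split_indicator_asm)
    have "prob (N t n \<inter> B t n) = prob ((\<lambda>\<omega>. (?f \<omega>, ?h \<omega>)) -` ({1} \<times> {..1 + t}) \<inter> space M)"
      unfolding N_eq B_eq by (rule arg_cong[where f = prob]) auto
    also have "\<dots> = prob (N t n) * prob (B t n)"
      unfolding N_eq B_eq by (rule indep_varD[OF ind]) auto
    finally show ?thesis .
  qed
  \<comment> \<open>Averaging \<open>\<phi> ^ n\<close> over the Poisson weights gives
    \<open>exp (- rate * t * (1 - \<phi>))\<close>; \<open>k\<close> collects all coefficients of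
    \<open>t\<close>.\<close>
  define k where "k = \<theta> - rate * (1 - \<phi>)"
  have "convergence_rate M X S \<pi> \<le> ereal (exp k)"
  proof (rule rate_bound_of_uncoupled_events[where D = "\<lambda>t n. N t n \<inter> B t n" and C = "exp \<theta>"
        and a = "\<lambda>t n. (rate * t) ^ n * exp (- rate * t) / fact n * (exp (\<theta> * (1 + t)) * \<phi> ^ n)"])
    show "N t n \<inter> B t n \<in> events" for t n by measurable
  next
    fix t :: real assume t: "0 \<le> t"
    show "AE \<omega> in M. (\<forall>n. \<omega> \<notin> N t n \<inter> B t n) \<longrightarrow>
        (\<forall>x\<in>{0..1}. \<forall>y\<in>{0..1}. workload_process x t \<omega> = workload_process y t \<omega>)"
      using AE_workload_eq[OF t] AE_space AE_service_pos
    proof eventually_elim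
      case (elim \<omega>)
      let ?W = "workload_at_epoch (\<lambda>i. X i \<omega>) (\<lambda>i. S i \<omega>)"
      from elim obtain n where n: "arrival_time n \<omega> \<le> t" "t < arrival_time (Suc n) \<omega>"
        "\<And>x. workload_process x t \<omega> = max (?W x n - (t - arrival_time n \<omega>)) 0" by blast
      show ?case
      proof (intro impI ballI)
        fix x y :: real assume "\<forall>n. \<omega> \<notin> N t n \<inter> B t n" and xy: "x \<in> {0..1}" "y \<in> {0..1}"
        then have "\<omega> \<notin> B t n" using n elim unfolding N_def by blast
        then have "1 + t < (\<Sum>i<n. b (S i \<omega>))" using elim unfolding B_def by simp
        \<comment> \<open>Services outside \<open>{\<beta><..1}\<close> are counted as 0, hence the
          appeal to positivity of the services.\<close>
        also have "\<dots> \<le> (\<Sum>i<n. S i \<omega>)"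
          by (intro sum_mono) (use elim in \<open>auto simp: b_def less_imp_le\<close>)
        finally have "1 + arrival_time n \<omega> \<le> (\<Sum>i<n. S i \<omega>)" using n by linarith
        from coupled_of_many_services[OF this xy]
        show "workload_process x t \<omega> = workload_process y t \<omega>" using n by simp
      qed
    qed
  next
    fix t :: real and n assume t: "0 \<le> t"
    have "prob (N t n \<inter> B t n) = (rate * t) ^ n * exp (- rate * t) / fact n * prob (B t n)"
      unfolding indep by (simp only: N_def prob_current_index[OF t])
    also have "\<dots> \<le> (rate * t) ^ n * exp (- rate * t) / fact n * (exp (\<theta> * (1 + t)) * \<phi> ^ n)"
      using rate_pos t by (intro mult_left_mono B_bound) auto
    finally show "emeasure M (N t n \<inter> B t n)
        \<le> ennreal ((rate * t) ^ n * exp (- rate * t) / fact n * (exp (\<theta> * (1 + t)) * \<phi> ^ n))"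
      by (simp only: emeasure_eq_measure ennreal_leI)
  next
    fix t :: real
    have "(\<lambda>n. exp (\<theta> * (1 + t) - rate * t) * ((rate * t * \<phi>) ^ n /\<^sub>R fact n)) sums
        (exp (\<theta> * (1 + t) - rate * t) * exp (rate * t * \<phi>))"
      by (intro sums_mult exp_converges)
    also have "(\<lambda>n. exp (\<theta> * (1 + t) - rate * t) * ((rate * t * \<phi>) ^ n /\<^sub>R fact n)) =
        (\<lambda>n. (rate * t) ^ n * exp (- rate * t) / fact n * (exp (\<theta> * (1 + t)) * \<phi> ^ n))"
      by (auto simp: exp_diff exp_minus power_mult_distrib field_simps)
    also have "exp (\<theta> * (1 + t) - rate * t) * exp (rate * t * \<phi>) = exp \<theta> * exp (k * t)"
      by (simp add: exp_add[symmetric] k_def algebra_simps)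
    finally show "(\<lambda>n. (rate * t) ^ n * exp (- rate * t) / fact n * (exp (\<theta> * (1 + t)) * \<phi> ^ n))
        sums (exp \<theta> * exp (k * t))" .
  qed (use \<phi> \<pi> rate_pos in auto)
  \<comment> \<open>By the choice of \<open>\<theta>\<close>, \<open>rate * (1 - \<phi>)\<close>
    equals \<open>rate * p - 1 / \<beta>\<close>.\<close>
  also have "k = 1 / \<beta> * ln (\<beta> * (rate * p)) + (1 / \<beta> - rate * p)"
    using \<beta> p rate_pos unfolding k_def \<phi>_def exp_\<theta> by (simp add: \<theta>_def field_simps)
  also have "exp \<dots> = (\<beta> * (rate * p)) powr (1 / \<beta>) * exp (1 / \<beta> - rate * p)"
    using load \<beta> p rate_pos by (simp add: powr_def exp_add)
  finally show ?thesis .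
qed

end

section \<open>Combining the two bounds\<close>

text \<open>After cancelling the factors in \<open>q\<close>, this is
  \<open>\<beta> powr (1 / \<beta>) * exp (1 / \<beta>) \<le> exp 1\<close>, once more from
  \<open>ln \<beta> \<le> \<beta> - 1\<close>. It passes from the Chernoff rate to the form used in
  the critical equation.\<close>

lemma saturation_bound_le_critical_rhs:
  fixes \<beta> q :: real
  assumes "\<beta> > 0" "q > 0"
  shows "(\<beta> * q) powr (1 / \<beta>) * exp (1 / \<beta> - q) \<le> q powr (1 / \<beta>) * exp (1 - q)"
proof -
  have "ln \<beta> \<le> \<beta> - 1" using assms by (simp add: ln_le_minus_one)
  then have "ln \<beta> / \<beta> + 1 / \<beta> \<le> 1" using assms by (simp add: field_simps)
  then have "\<beta> powr (1 / \<beta>) * exp (1 / \<beta>) \<le> exp 1"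
    using assms by (simp add: powr_def flip: exp_add)
  then have "\<beta> powr (1 / \<beta>) * exp (1 / \<beta>) * (q powr (1 / \<beta>) * exp (- q)) \<le> exp 1 * (q powr (1 / \<beta>) * exp (- q))"
    by (intro mult_right_mono) auto
  moreover have "exp (a - q) = exp a * exp (- q)" for a by (simp flip: exp_add)
  ultimately show ?thesis using assms by (simp add: powr_mult mult_ac)
qed

theorem theorem2:
  fixes \<beta> p :: real
  assumes "\<beta> > 0" and "p > 0"
  shows "(\<exists>!l. l \<in> {1 / (p * \<beta>)<..} \<and> critical_equation p \<beta> l) \<and>
    (\<forall>G\<in>service_class \<beta> p. \<forall>rate>0. \<forall>(M :: 'a measure) X S \<pi>.
       truncated_workload_model M X S rate G \<longrightarrow> invariant_distribution M X S \<pi> \<longrightarrow>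
       convergence_rate M X S \<pi> \<le> ereal (1 - exp (- critical_rate p \<beta>))) \<and>
    1 - exp (- critical_rate p \<beta>) < 1"
proof (intro conjI ballI allI impI)
  show ex1: "\<exists>!l. l \<in> {1 / (p * \<beta>)<..} \<and> critical_equation p \<beta> l"
    by (rule ex1_critical_rate[OF assms])
  let ?c = "critical_rate p \<beta>"
  have c: "1 / (p * \<beta>) < ?c" "critical_equation p \<beta> ?c"
    using theI'[OF ex1] by (simp_all add: critical_rate_def)
  show "1 - exp (- ?c) < 1" by simp
  fix G rate X S \<pi> and M :: "'a measure"
  assume G: "G \<in> service_class \<beta> p" and "0 < rate" and model: "truncated_workload_model M X S rate G"
    and \<pi>: "invariant_distribution M X S \<pi>"
  interpret truncated_workload_model M X S rate G by (rule model)
  show "convergence_rate M X S \<pi> \<le> ereal (1 - exp (- ?c))"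
  proof (cases "rate \<le> ?c")
    case True
    have "convergence_rate M X S \<pi> \<le> ereal (1 - exp (- rate))" by (rule convergence_rate_le_idle[OF \<pi>])
    also have "\<dots> \<le> ereal (1 - exp (- ?c))" using True by simp
    finally show ?thesis .
  next
    case False
    have "convergence_rate M X S \<pi> \<le> ereal ((\<beta> * (rate * p)) powr (1 / \<beta>) * exp (1 / \<beta> - rate * p))"
      using c(1) False by (intro convergence_rate_le_saturation[OF \<pi> G assms]) linarith
    also have "\<dots> \<le> ereal ((rate * p) powr (1 / \<beta>) * exp (1 - rate * p))"
      using saturation_bound_le_critical_rhs[of \<beta> "rate * p"] assms rate_pos by simp
    also have "\<dots> \<le> ereal ((?c * p) powr (1 / \<beta>) * exp (1 - ?c * p))"
      using critical_rhs_strict_antimono[OF assms, of ?c rate] c(1) False by simp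
    also have "\<dots> = ereal (1 - exp (- ?c))" using c(2) by (simp add: critical_equation_def)
    finally show ?thesis .
  qed
qed

end
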